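(* Let $0 \le r \leq d$ be integers and let $Q_r \subseteq Q_d$ be a subgraph of the $d$-dimensional hypercube $Q_d$ isomorphic to the $r$-dimensional hypercube. If $\varphi$ is a proper $d$-edge coloring of $Q_r$ (a proper edge coloring of all edges of $Q_r$ with colors from $\{1,\dots,d\}$), then $\varphi$ can be extended to a proper $d$-edge coloring of $Q_d$.
   Context: $Q_d$ is the $d$-dimensional hypercube graph. A proper edge coloring assigns distinct colors to adjacent edges; a proper $d$-edge coloring uses colors from $\{1,\dots,d\}$. An extension of $\varphi$ is a coloring of $Q_d$ that agrees with $\varphi$ on all edges of $Q_r$. *)

theory Defs
  imports Main
begin

record 'a ugraph =
  verts :: "'a set"
  edges :: "'a set set"

definition simple_graph :: "'a ugraph \<Rightarrow> bool" where
  "simple_graph G \<longleftrightarrow> (\<forall>e\<in>edges G. e \<subseteq> verts G \<and> card e = 2)"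

definition subgraph :: "'a ugraph \<Rightarrow> 'a ugraph \<Rightarrow> bool" where
  "subgraph H G \<longleftrightarrow>
     simple_graph H \<and> simple_graph G \<and> verts H \<subseteq> verts G \<and> edges H \<subseteq> edges G"

definition isomorphic :: "'a ugraph \<Rightarrow> 'b ugraph \<Rightarrow> bool" where
  "isomorphic G H \<longleftrightarrow>
     (\<exists>f. bij_betw f (verts G) (verts H) \<and>
          (\<forall>u\<in>verts G. \<forall>v\<in>verts G. {u, v} \<in> edges G \<longleftrightarrow> {f u, f v} \<in> edges H))"

definition hypercube :: "nat \<Rightarrow> bool list ugraph" where
  "hypercube d =
     \<lparr>verts = {u. length u = d},
      edges = {{u, v} | u v. length u = d \<and> length v = d \<and> card {i. i < d \<and> u ! i \<noteq> v ! i} = 1}\<rparr>"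

text \<open>
  A coloring is a total function on vertex sets, but only its values on the edges of \<open>G\<close> matter.
\<close>

definition proper_edge_coloring :: "'a ugraph \<Rightarrow> ('a set \<Rightarrow> 'c) \<Rightarrow> bool" where
  "proper_edge_coloring G \<phi> \<longleftrightarrow>
     (\<forall>e\<in>edges G. \<forall>e'\<in>edges G. e \<noteq> e' \<and> e \<inter> e' \<noteq> {} \<longrightarrow> \<phi> e \<noteq> \<phi> e')"

definition proper_k_edge_coloring :: "nat \<Rightarrow> 'a ugraph \<Rightarrow> ('a set \<Rightarrow> nat) \<Rightarrow> bool" where
  "proper_k_edge_coloring k G \<phi> \<longleftrightarrow>
     (\<forall>e\<in>edges G. \<phi> e \<in> {1..k}) \<and> proper_edge_coloring G \<phi>"

definition extends_coloring :: "'a ugraph \<Rightarrow> ('a set \<Rightarrow> 'c) \<Rightarrow> ('a set \<Rightarrow> 'c) \<Rightarrow> bool" where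
  "extends_coloring H \<phi> \<psi> \<longleftrightarrow> (\<forall>e\<in>edges H. \<psi> e = \<phi> e)"

lemma simple_graph_hypercube: "simple_graph (hypercube d)"
proof -
  have "u \<noteq> v" if "card {i. i < d \<and> u ! i \<noteq> v ! i} = 1" for u v :: "bool list"
    using that by auto
  then show ?thesis
    by (fastforce simp: simple_graph_def hypercube_def card_2_iff)
qed

end

theory Submission
  imports Defs
begin

text \<open>
  One dimension at a time, the extension is easy. Color a second copy of the subcube like the
  first one. The two copies of a vertex then see the same colors, fewer than \<open>d\<close> of them, so a color
  is left for the edge that joins them.

  The proof takes all these steps at once. Let the subcube vary in the directions \<open>D\<close> and let
  \<open>p\<close> be the projection of the big cube onto it. An edge in a direction of \<open>D\<close> is projected to an
  edge of the subcube and inherits its color. An edge in a direction outside \<open>D\<close> is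
  projected to a vertex \<open>w\<close>; its color depends only on \<open>w\<close> and the direction, and is chosen by an
  injection from the \<open>d - card D\<close> outer directions into the colors that do not occur at \<open>w\<close>. There
  are enough of those because \<open>w\<close> has degree \<open>card D\<close> in the subcube. This is
  \<open>extend_coloring_from_subcube\<close>.

  A subgraph of the cube that is isomorphic to a cube has to be shown to be such a subcube
  (\<open>isomorphic_hypercube_imp_subcube\<close>). The reason is that two edges at a vertex lie
  in only one 4-cycle of the cube (\<open>square_completion\<close>), so the images of the neighbors of one
  vertex determine the whole embedding.
\<close>

section \<open>Edges and directions of the hypercube\<close>

definition flip :: "nat \<Rightarrow> bool list \<Rightarrow> bool list" where
  "flip i u = u[i := \<not> u ! i]"

definition subcube :: "nat \<Rightarrow> bool list \<Rightarrow> nat set \<Rightarrow> bool list set" where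
  "subcube d a D = {u. length u = d \<and> (\<forall>k<d. k \<notin> D \<longrightarrow> u ! k = a ! k)}"

definition retract :: "nat \<Rightarrow> bool list \<Rightarrow> nat set \<Rightarrow> bool list \<Rightarrow> bool list" where
  "retract d a D u = map (\<lambda>k. if k \<in> D then u ! k else a ! k) [0..<d]"

definition differ :: "nat \<Rightarrow> bool list \<Rightarrow> bool list \<Rightarrow> nat set" where
  "differ d u v = {k. k < d \<and> u ! k \<noteq> v ! k}"

text \<open>
  For an edge this set is the singleton of its direction. It is defined on sets of vertices so that a
  coloring, which takes an unordered edge, can be defined from it without choosing an end.
\<close>

definition dirs :: "nat \<Rightarrow> bool list set \<Rightarrow> nat set" where
  "dirs d e = {k. k < d \<and> (\<exists>u\<in>e. \<exists>v\<in>e. u ! k \<noteq> v ! k)}"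

definition indicator_list :: "nat \<Rightarrow> nat set \<Rightarrow> bool list" where
  "indicator_list r A = map (\<lambda>i. i \<in> A) [0..<r]"

lemma length_flip [simp]: "length (flip i u) = length u"
  by (simp add: flip_def)

lemma nth_flip: "k < length u \<Longrightarrow> flip i u ! k = (if k = i then \<not> u ! k else u ! k)"
  by (auto simp: flip_def nth_list_update)

lemma flip_flip [simp]: "flip i (flip i u) = u"
  by (rule nth_equalityI) (simp_all add: nth_flip)

lemma differ_eq_singleton_iff:
  assumes "length u = d" "length v = d" "i < d"
  shows "differ d u v = {i} \<longleftrightarrow> v = flip i u"
proof
  assume "differ d u v = {i}"
  then have *: "k < d \<Longrightarrow> (u ! k \<noteq> v ! k) = (k = i)" for k
    unfolding differ_def by blast
  show "v = flip i u"
    using assms * by (intro nth_equalityI) (auto simp: nth_flip)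
qed (use assms in \<open>auto simp: differ_def nth_flip split: if_splits\<close>)

lemma edge_hypercube_iff:
  "{u, v} \<in> edges (hypercube d) \<longleftrightarrow> length u = d \<and> length v = d \<and> card (differ d u v) = 1"
proof -
  have "differ d u v = differ d v u"
    by (auto simp: differ_def)
  moreover have "edges (hypercube d) =
      {{u, v} | u v. length u = d \<and> length v = d \<and> card (differ d u v) = 1}"
    by (simp add: hypercube_def differ_def)
  ultimately show ?thesis
    by (auto simp: doubleton_eq_iff)
qed

lemma edges_hypercube:
  "edges (hypercube d) = {{u, flip i u} | u i. length u = d \<and> i < d}"
proof (intro set_eqI iffI)
  fix e assume "e \<in> edges (hypercube d)"
  then obtain u v where e: "e = {u, v}" and uv: "length u = d" "length v = d"
    and "card (differ d u v) = 1"
    by (auto simp: hypercube_def differ_def)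
  then obtain i where i: "differ d u v = {i}"
    by (auto simp: card_1_singleton_iff)
  moreover from this have "i < d"
    unfolding differ_def by blast
  ultimately show "e \<in> {{u, flip i u} | u i. length u = d \<and> i < d}"
    using e uv differ_eq_singleton_iff by blast
next
  fix e assume "e \<in> {{u, flip i u} | u i. length u = d \<and> i < d}"
  then obtain u i where "e = {u, flip i u}" "length u = d" "i < d"
    by blast
  moreover from this have "differ d u (flip i u) = {i}"
    by (subst differ_eq_singleton_iff) auto
  ultimately show "e \<in> edges (hypercube d)"
    by (simp add: edge_hypercube_iff)
qed

lemma hypercube_edge_at:
  assumes "e \<in> edges (hypercube d)" "u \<in> e"
  obtains i where "length u = d" "i < d" "e = {u, flip i u}"
  using assms by (auto simp: edges_hypercube insert_commute)

section \<open>Cubes inside a cube\<close>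

text \<open>
  The vertices \<open>insert p C\<close> and \<open>insert q C\<close> of the cube of subsets have exactly two common
  neighbors, of which \<open>C\<close> is one: a neighbor of \<open>insert p C\<close> without \<open>p\<close> is \<open>C\<close>, likewise for \<open>q\<close>, and
  a neighbor of \<open>insert p C\<close> that contains \<open>p\<close> and \<open>q\<close> has gained just \<open>q\<close>.
\<close>

lemma square_completion:
  assumes "p \<noteq> q" "p \<notin> C" "q \<notin> C"
    and "card (sym_diff (insert p C) Z) = 1" "card (sym_diff (insert q C) Z) = 1"
    and "Z \<noteq> C"
  shows "Z = insert p (insert q C)"
proof -
  obtain s t where s: "sym_diff (insert p C) Z = {s}" and t: "sym_diff (insert q C) Z = {t}"
    using assms(4,5) by (auto simp: card_1_singleton_iff)
  have S: "(x \<in> Z) = ((x = p \<or> x \<in> C) \<noteq> (x = s))" for x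
  proof -
    have "x \<in> sym_diff (insert p C) Z \<longleftrightarrow> x = s" using s by simp
    then show ?thesis by (auto)
  qed
  have T: "(x \<in> Z) = ((x = q \<or> x \<in> C) \<noteq> (x = t))" for x
  proof -
    have "x \<in> sym_diff (insert q C) Z \<longleftrightarrow> x = t" using t by simp
    then show ?thesis by (auto)
  qed
  have "p \<in> Z"
  proof (rule ccontr)
    assume "p \<notin> Z"
    then have "s = p" using S[of p] by simp
    then have "x \<in> Z \<longleftrightarrow> x \<in> C" for x using S[of x] assms(2) by (cases "x = p") simp_all
    then show False using assms(6) by blast
  qed
  have "q \<in> Z"
  proof (rule ccontr)
    assume "q \<notin> Z"
    then have "t = q" using T[of q] by simp
    then have "x \<in> Z \<longleftrightarrow> x \<in> C" for x using T[of x] assms(3) by (cases "x = q") simp_all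
    then show False using assms(6) by blast
  qed
  then have "s = q" using S[of q] assms(1,3) by simp
  then have "x \<in> Z \<longleftrightarrow> x \<in> insert p (insert q C)" for x
    using S[of x] \<open>p \<in> Z\<close> \<open>q \<in> Z\<close> by (cases "x = q") simp_all
  then show ?thesis by blast
qed

text \<open>
  An embedding that fixes the empty set sends singletons to singletons, which gives \<open>\<delta>\<close>. A set \<open>A\<close>
  with distinct elements \<open>i\<close> and \<open>j\<close> is the corner of a square whose other corners are smaller sets, so by
  induction and \<open>square_completion\<close> its image is forced.
\<close>

lemma subset_cube_embedding:
  fixes G :: "'a set \<Rightarrow> 'b set"
  assumes "finite R" and inj: "inj_on G (Pow R)" and empty: "G {} = {}"
    and adj: "\<And>A i. A \<subseteq> R \<Longrightarrow> i \<in> R \<Longrightarrow> i \<notin> A \<Longrightarrow> card (sym_diff (G A) (G (insert i A))) = 1"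
  shows "\<exists>\<delta>. inj_on \<delta> R \<and> (\<forall>A\<subseteq>R. G A = \<delta> ` A)"
proof -
  have "\<exists>p. G {i} = {p}" if "i \<in> R" for i
    using adj[of "{}" i] that empty by (simp add: card_1_singleton_iff)
  then obtain \<delta> where \<delta>: "\<And>i. i \<in> R \<Longrightarrow> G {i} = {\<delta> i}"
    by metis
  have inj\<delta>: "inj_on \<delta> R"
  proof (rule inj_onI)
    fix i j assume "i \<in> R" "j \<in> R" "\<delta> i = \<delta> j"
    then have "G {i} = G {j}" using \<delta> by simp
    then show "i = j"
      using inj_onD[OF inj] \<open>i \<in> R\<close> \<open>j \<in> R\<close> by blast
  qed
  have "G A = \<delta> ` A" if "A \<subseteq> R" for A
    using finite_subset[OF that \<open>finite R\<close>] that
  proof (induction A rule: finite_psubset_induct)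
    case (psubset A)
    consider "A = {}" | i where "A = {i}" | i j where "i \<in> A" "j \<in> A" "i \<noteq> j"
      by blast
    then show ?case
    proof cases
      case 3
      define B where "B = A - {i, j}"
      have A: "A = insert i (insert j B)" "i \<notin> B" "j \<notin> B"
        using 3 by (auto simp: B_def)
      have R: "i \<in> R" "j \<in> R" "B \<subseteq> R"
        using psubset.prems A by auto
      have GB: "G B = \<delta> ` B" "G (insert i B) = insert (\<delta> i) (\<delta> ` B)"
        "G (insert j B) = insert (\<delta> j) (\<delta> ` B)"
      proof -
        have "B \<subset> A" "insert i B \<subset> A" "insert j B \<subset> A"
          using A 3 by auto
        then show "G B = \<delta> ` B" "G (insert i B) = insert (\<delta> i) (\<delta> ` B)"
          "G (insert j B) = insert (\<delta> j) (\<delta> ` B)"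
          using psubset.IH[of B] psubset.IH[of "insert i B"] psubset.IH[of "insert j B"] R
          by simp_all
      qed
      have "\<delta> i \<noteq> \<delta> j" "\<delta> i \<notin> \<delta> ` B" "\<delta> j \<notin> \<delta> ` B"
        using inj\<delta> R A 3 by (auto simp: inj_on_def)
      moreover have "card (sym_diff (G (insert i B)) (G A)) = 1"
        using adj[of "insert i B" j] A R 3 by (auto simp: insert_commute)
      moreover have "card (sym_diff (G (insert j B)) (G A)) = 1"
        using adj[of "insert j B" i] A R 3 by (auto simp: insert_commute)
      moreover have "G A \<noteq> G B"
        using inj_onD[OF inj, of A B] psubset.prems A R by auto
      ultimately have "G A = insert (\<delta> i) (insert (\<delta> j) (\<delta> ` B))"
        using GB by (intro square_completion) auto
      then show ?thesis using A by simp
    qed (use psubset.prems empty \<delta> in auto)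
  qed
  with inj\<delta> show ?thesis by blast
qed

lemma indicator_list_bij:
  "bij_betw (indicator_list r) (Pow {..<r}) (verts (hypercube r))"
proof (rule bij_betw_byWitness[where f' = "\<lambda>x. {i. i < r \<and> x ! i}"])
  show "\<forall>x\<in>verts (hypercube r). indicator_list r {i. i < r \<and> x ! i} = x"
    by (auto intro!: nth_equalityI simp: indicator_list_def hypercube_def)
qed (auto simp: indicator_list_def hypercube_def)

lemma differ_indicator_list:
  "A \<subseteq> {..<r} \<Longrightarrow> B \<subseteq> {..<r} \<Longrightarrow> differ r (indicator_list r A) (indicator_list r B) = sym_diff A B"
  by (auto simp: differ_def indicator_list_def)

lemma differ_eq_sym_diff: "differ d u v = sym_diff (differ d a u) (differ d a v)"
  by (auto simp: differ_def)

text \<open>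
  Recording each vertex of \<open>H\<close> by the set of coordinates where it differs from a fixed vertex \<open>a\<close>
  turns the isomorphism into an embedding of cubes of subsets that fixes the empty set. Such an
  embedding is \<open>A \<mapsto> \<delta> ` A\<close>, so the vertices of \<open>H\<close> are those that differ from \<open>a\<close> only inside the range
  of \<open>\<delta>\<close>. That \<open>H\<close> contains every cube edge between its vertices holds since \<open>\<delta>\<close>, being injective,
  also reflects adjacency.
\<close>

lemma isomorphic_hypercube_imp_subcube:
  assumes sub: "subgraph H (hypercube d)" and "isomorphic H (hypercube r)"
  obtains a D where "D \<subseteq> {..<d}" "verts H = subcube d a D"
    "edges H = {{u, flip i u} | u i. u \<in> subcube d a D \<and> i \<in> D}"
proof -
  obtain f where f: "bij_betw f (verts H) (verts (hypercube r))"
    and fe: "\<And>u v. u \<in> verts H \<Longrightarrow> v \<in> verts H \<Longrightarrow>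
      {u, v} \<in> edges H \<longleftrightarrow> {f u, f v} \<in> edges (hypercube r)"
    using assms(2) unfolding isomorphic_def by blast
  define h where "h = inv_into (verts H) f \<circ> indicator_list r"
  have h: "bij_betw h (Pow {..<r}) (verts H)"
    unfolding h_def by (rule bij_betw_trans[OF indicator_list_bij bij_betw_inv_into[OF f]])
  have fh: "f (h A) = indicator_list r A" if "A \<subseteq> {..<r}" for A
  proof -
    have "indicator_list r A \<in> verts (hypercube r)"
      using bij_betw_apply[OF indicator_list_bij] that by blast
    then show ?thesis
      unfolding h_def comp_def by (rule bij_betw_inv_into_right[OF f])
  qed
  have hv: "h A \<in> verts H" if "A \<subseteq> {..<r}" for A
    using bij_betw_apply[OF h] that by blast
  have len: "length u = d" if "u \<in> verts H" for u
    using sub that by (auto simp: subgraph_def hypercube_def)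
  have he: "{h A, h B} \<in> edges H \<longleftrightarrow> card (sym_diff A B) = 1"
    if "A \<subseteq> {..<r}" "B \<subseteq> {..<r}" for A B
    unfolding fe[OF hv[OF that(1)] hv[OF that(2)]] fh[OF that(1)] fh[OF that(2)]
      edge_hypercube_iff differ_indicator_list[OF that]
    by (simp add: indicator_list_def)
  define a where "a = h {}"
  define G where "G A = differ d a (h A)" for A
  have supp_inj: "u = v" if "differ d a u = differ d a v" "length u = d" "length v = d" for u v
  proof (rule nth_equalityI)
    fix k assume "k < length u"
    moreover have "(k < d \<and> a ! k \<noteq> u ! k) = (k < d \<and> a ! k \<noteq> v ! k)"
      using that(1) unfolding differ_def by blast
    ultimately show "u ! k = v ! k"
      using that(2) by auto
  qed (use that in simp)
  have "inj_on G (Pow {..<r})"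
  proof (rule inj_onI)
    fix A B assume AB: "A \<in> Pow {..<r}" "B \<in> Pow {..<r}" "G A = G B"
    then have "h A = h B"
      using supp_inj[of "h A" "h B"] len[OF hv[of A]] len[OF hv[of B]] by (simp add: G_def)
    then show "A = B" using inj_onD[OF bij_betw_imp_inj_on[OF h]] AB by blast
  qed
  moreover have "G {} = {}"
    by (simp add: G_def a_def differ_def)
  moreover have "card (sym_diff (G A) (G (insert i A))) = 1"
    if "A \<subseteq> {..<r}" "i \<in> {..<r}" "i \<notin> A" for A i
  proof -
    have "sym_diff A (insert i A) = {i}"
      using that by (auto)
    then have "{h A, h (insert i A)} \<in> edges H"
      using he that by simp
    then have "{h A, h (insert i A)} \<in> edges (hypercube d)"
      using sub by (auto simp: subgraph_def)
    then show ?thesis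
      unfolding edge_hypercube_iff G_def differ_eq_sym_diff[symmetric] by blast
  qed
  ultimately have "\<exists>\<delta>. inj_on \<delta> {..<r} \<and> (\<forall>A\<subseteq>{..<r}. G A = \<delta> ` A)"
    by (intro subset_cube_embedding) simp_all
  then obtain \<delta> where inj\<delta>: "inj_on \<delta> {..<r}" and \<delta>: "\<And>A. A \<subseteq> {..<r} \<Longrightarrow> G A = \<delta> ` A"
    by blast
  define D where "D = \<delta> ` {..<r}"
  have Dd: "D \<subseteq> {..<d}"
    unfolding D_def \<delta>[OF subset_refl, symmetric] by (auto simp: G_def differ_def)
  have in_subcube: "u \<in> subcube d a D \<longleftrightarrow> length u = d \<and> differ d a u \<subseteq> D" for u
    by (auto simp: subcube_def differ_def)
  have img: "verts H = h ` Pow {..<r}"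
    using h by (simp add: bij_betw_def)
  have V: "verts H = subcube d a D"
  proof (intro set_eqI iffI)
    fix u assume u: "u \<in> verts H"
    then obtain A where "A \<subseteq> {..<r}" "u = h A"
      unfolding img by blast
    then have "differ d a u \<subseteq> D"
      using \<delta>[of A] by (auto simp: G_def D_def)
    then show "u \<in> subcube d a D"
      using len[OF u] in_subcube by simp
  next
    fix u assume "u \<in> subcube d a D"
    then have u: "length u = d" "differ d a u \<subseteq> \<delta> ` {..<r}"
      unfolding in_subcube unfolding D_def by simp_all
    then obtain A where A: "A \<subseteq> {..<r}" "differ d a u = \<delta> ` A"
      by (meson subset_image_iff)
    then have "differ d a u = differ d a (h A)"
      using \<delta>[of A] by (simp add: G_def)
    then have "u = h A"
      using u(1) len[OF hv[OF A(1)]] by (rule supp_inj)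
    then show "u \<in> verts H" using hv A by simp
  qed
  have "edges H = {{u, flip i u} | u i. u \<in> subcube d a D \<and> i \<in> D}"
  proof (intro set_eqI iffI)
    fix e assume e: "e \<in> edges H"
    then have eQ: "e \<in> edges (hypercube d)" and ev: "e \<subseteq> verts H"
      using sub by (auto simp: subgraph_def simple_graph_def)
    from eQ obtain u i where ui: "e = {u, flip i u}" "length u = d" "i < d"
      unfolding edges_hypercube by blast
    have "u \<in> subcube d a D" "flip i u \<in> subcube d a D"
      using ev V ui by simp_all
    moreover from this have "i \<in> D"
      using ui nth_flip[of i u i] by (force simp: subcube_def)
    ultimately show "e \<in> {{u, flip i u} | u i. u \<in> subcube d a D \<and> i \<in> D}"
      using ui by blast
  next
    fix e assume "e \<in> {{u, flip i u} | u i. u \<in> subcube d a D \<and> i \<in> D}"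
    then obtain u i where ui: "e = {u, flip i u}" "u \<in> subcube d a D" "i \<in> D"
      by blast
    have id: "i < d" using ui Dd by auto
    have "flip i u \<in> subcube d a D"
      using ui by (auto simp: subcube_def nth_flip)
    then have "u \<in> h ` Pow {..<r}" "flip i u \<in> h ` Pow {..<r}"
      using ui V img by simp_all
    then obtain A B where AB: "A \<subseteq> {..<r}" "B \<subseteq> {..<r}" "u = h A" "flip i u = h B"
      by blast
    have "differ d u (flip i u) = {i}"
      using ui id by (subst differ_eq_singleton_iff) (simp_all add: subcube_def)
    then have "card (sym_diff (\<delta> ` A) (\<delta> ` B)) = 1"
      using AB(3,4) \<delta>[OF AB(1)] \<delta>[OF AB(2)] differ_eq_sym_diff[of d u "flip i u" a]
      by (simp add: G_def)
    moreover have "sym_diff (\<delta> ` A) (\<delta> ` B) = \<delta> ` sym_diff A B"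
      using inj_on_image_set_diff[OF inj\<delta>, of A B] inj_on_image_set_diff[OF inj\<delta>, of B A] AB(1,2)
      by (simp add: image_Un subset_iff)
    moreover have "inj_on \<delta> (sym_diff A B)"
      using AB by (intro inj_on_subset[OF inj\<delta>]) (auto)
    ultimately have "card (sym_diff A B) = 1"
      by (simp add: card_image)
    then show "e \<in> edges H"
      using he AB ui by simp
  qed
  with Dd V show ?thesis by (rule that)
qed

section \<open>Extending the coloring\<close>

lemma retract_in_subcube: "retract d a D u \<in> subcube d a D"
  by (auto simp: retract_def subcube_def)

lemma retract_subcube: "u \<in> subcube d a D \<Longrightarrow> retract d a D u = u"
  by (intro nth_equalityI) (auto simp: retract_def subcube_def)

lemma retract_flip:
  "length u = d \<Longrightarrow> retract d a D (flip i u) =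
    (if i \<in> D then flip i (retract d a D u) else retract d a D u)"
  by (intro nth_equalityI) (auto simp: retract_def nth_flip)

lemma dirs_edge: "length u = d \<Longrightarrow> i < d \<Longrightarrow> dirs d {u, flip i u} = {i}"
  by (auto simp: dirs_def nth_flip split: if_splits)

text \<open>
  Two edges at a vertex \<open>u\<close> have different directions. If both directions are in \<open>D\<close>, they are projected
  to different edges at \<open>p u\<close>, which \<open>\<phi>\<close> separates; if neither is, the injection at \<open>p u\<close> separates
  them; in the mixed case only one of the colors occurs at \<open>p u\<close> in the subcube.
\<close>

lemma extend_coloring_from_subcube:
  assumes Dd: "D \<subseteq> {..<d}"
    and E: "edges H = {{u, flip i u} | u i. u \<in> subcube d a D \<and> i \<in> D}"
    and col: "proper_k_edge_coloring d H \<phi>"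
  shows "\<exists>\<psi>. proper_k_edge_coloring d (hypercube d) \<psi> \<and> extends_coloring H \<phi> \<psi>"
proof -
  define used where "used w = (\<lambda>i. \<phi> {w, flip i w}) ` D" for w
  let ?S = "subcube d a D"
  have "\<exists>g. inj_on g ({..<d} - D) \<and> g ` ({..<d} - D) \<subseteq> {1..d} - used w" for w
  proof -
    have fin: "finite D" using Dd finite_subset by blast
    have "card (used w) \<le> card D"
      unfolding used_def using fin by (rule card_image_le)
    moreover have "card ({1..d} - used w) \<ge> d - card (used w)"
      using diff_card_le_card_Diff[of "used w" "{1..d}"] fin by (simp add: used_def)
    moreover have "card ({..<d} - D) = d - card D"
      using Dd fin by (simp add: card_Diff_subset)
    ultimately have "card ({..<d} - D) \<le> card ({1..d} - used w)"
      by linarith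
    then show ?thesis
      by (metis card_le_inj finite_Diff finite_atLeastAtMost finite_lessThan)
  qed
  then obtain g where g_inj: "\<And>w. inj_on (g w) ({..<d} - D)"
    and g_range: "\<And>w i. i < d \<Longrightarrow> i \<notin> D \<Longrightarrow> g w i \<in> {1..d} - used w"
    by (metis (no_types, lifting) Diff_iff image_subset_iff lessThan_iff)
  define p where "p = retract d a D"
  define \<psi> where "\<psi> e = (let i = the_elem (dirs d e) in
      if i \<in> D then \<phi> (p ` e) else g (the_elem (p ` e)) i)" for e
  have \<psi>: "\<psi> {u, flip i u} = (if i \<in> D then \<phi> {p u, flip i (p u)} else g (p u) i)"
    if "length u = d" "i < d" for u i
    using that by (simp add: \<psi>_def dirs_edge p_def retract_flip)
  have pE: "{p u, flip i (p u)} \<in> edges H" if "i \<in> D" for u i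
    using that retract_in_subcube unfolding E p_def by blast
  have col_range: "\<And>e. e \<in> edges H \<Longrightarrow> \<phi> e \<in> {1..d}"
    and col_proper: "\<And>e e'. e \<in> edges H \<Longrightarrow> e' \<in> edges H \<Longrightarrow> e \<noteq> e' \<Longrightarrow> e \<inter> e' \<noteq> {} \<Longrightarrow> \<phi> e \<noteq> \<phi> e'"
    using col unfolding proper_k_edge_coloring_def proper_edge_coloring_def by blast+
  have "\<psi> e \<in> {1..d}" if e: "e \<in> edges (hypercube d)" for e
  proof -
    obtain u i where "e = {u, flip i u}" "length u = d" "i < d"
      using e unfolding edges_hypercube by blast
    then show ?thesis
      using \<psi>[of u i] col_range[OF pE, of i u] g_range[of i "p u"] by auto
  qed
  moreover have "\<psi> e \<noteq> \<psi> e'"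
    if e: "e \<in> edges (hypercube d)" "e' \<in> edges (hypercube d)" "e \<noteq> e'" "e \<inter> e' \<noteq> {}" for e e'
  proof -
    obtain u where u: "u \<in> e" "u \<in> e'" using e(4) by blast
    obtain i where i: "length u = d" "i < d" "e = {u, flip i u}"
      using e(1) u(1) by (rule hypercube_edge_at)
    obtain j where j: "j < d" "e' = {u, flip j u}"
      using e(2) u(2) by (rule hypercube_edge_at)
    have ij: "i \<noteq> j" using e(3) i j by blast
    have "\<phi> {p u, flip i (p u)} \<noteq> \<phi> {p u, flip j (p u)}" if "i \<in> D" "j \<in> D"
    proof (rule col_proper[OF pE pE])
      have "flip i (p u) ! i \<noteq> flip j (p u) ! i"
        using ij i by (simp add: nth_flip p_def retract_def)
      then show "{p u, flip i (p u)} \<noteq> {p u, flip j (p u)}"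
        by (auto simp: doubleton_eq_iff)
    qed (use that in auto)
    moreover have "\<phi> {p u, flip k (p u)} \<noteq> g (p u) l" if "k \<in> D" "l \<notin> D" "l < d" for k l
    proof -
      have "\<phi> {p u, flip k (p u)} \<in> used (p u)"
        unfolding used_def using that(1) by (rule imageI)
      then show ?thesis
        using g_range[OF that(3,2), of "p u"] by auto
    qed
    moreover have "g (p u) i \<noteq> g (p u) j" if "i \<notin> D" "j \<notin> D"
      using inj_onD[OF g_inj, of "p u" i j] that ij i j by blast
    ultimately show ?thesis
      using \<psi>[of u i] \<psi>[of u j] i j by (metis (full_types))
  qed
  moreover have "\<psi> e = \<phi> e" if e: "e \<in> edges H" for e
  proof -
    obtain u i where ui: "e = {u, flip i u}" "u \<in> ?S" "i \<in> D"
      using e E by blast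
    then have "length u = d" "i < d" using Dd by (auto simp: subcube_def)
    then show ?thesis
      using \<psi>[of u i] ui retract_subcube[of u d a D] by (simp add: p_def)
  qed
  ultimately show ?thesis
    unfolding proper_k_edge_coloring_def proper_edge_coloring_def extends_coloring_def by blast
qed

theorem proposition3p2:
  fixes r d :: nat
    and H :: "bool list ugraph"
    and \<phi> :: "bool list set \<Rightarrow> nat"
  assumes "r \<le> d"
    and "subgraph H (hypercube d)"
    and "isomorphic H (hypercube r)"
    and "proper_k_edge_coloring d H \<phi>"
  shows "\<exists>\<psi>. proper_k_edge_coloring d (hypercube d) \<psi> \<and> extends_coloring H \<phi> \<psi>"
proof -
  obtain a D where "D \<subseteq> {..<d}"
    "edges H = {{u, flip i u} | u i. u \<in> subcube d a D \<and> i \<in> D}"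
    using isomorphic_hypercube_imp_subcube[OF assms(2,3)] .
  then show ?thesis
    using assms(4) by (rule extend_coloring_from_subcube)
qed

end
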